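(* Let $\mathcal M=(E_1,\rho_{\mathcal M})$ and $\mathcal N=(E_2,\rho_{\mathcal N})$ be $q$-matroids with projectivization matroids $P(\mathcal M)=(\mathbb PE_1,r_{P(\mathcal M)})$ and $P(\mathcal N)=(\mathbb PE_2,r_{P(\mathcal N)})$, and let $\sigma:E_1\to E_2$ be an $\mathcal L$-map. Then the induced map $\sigma_{\mathcal L}:\mathbb P_oE_1\to\mathbb P_oE_2$ is a map of matroids $P(\mathcal M)\to P(\mathcal N)$, and: (i) $\sigma$ is $q$-weak if and only if $\sigma_{\mathcal L}$ is weak; (ii) $\sigma$ is $q$-strong if and only if $\sigma_{\mathcal L}$ is strong.
   Context: A $q$-matroid is a pair $\mathcal M=(E,\rho)$ where $E$ is a finite-dimensional vector space over the finite field $\mathbb F_q$ and $\rho$ assigns to each subspace of $E$ a nonnegative integer such that $0\le\rho(V)\le\dim V$, $V\le W\Rightarrow\rho(V)\le\rho(W)$, and $\rho(V+W)+\rho(V\cap W)\le\rho(V)+\rho(W)$. A flat of $\mathcal M$ is a subspace $F$ with $\rho(F+\langle v\rangle)>\rho(F)$ for all $v\notin F$. For a finite-dimensional $\mathbb F_q$-space $E$, $\mathbb PE$ is the set of $1$-dimensional subspaces of $E$; for $S\subseteq\mathbb PE$, $\langle S\rangle$ denotes the $\mathbb F_q$-span of the union of the lines in $S$. The projectivization matroid of $\mathcal M=(E,\rho)$ is the matroid $P(\mathcal M)=(\mathbb PE,r)$ with $r(S)=\rho(\langle S\rangle)$. For a matroid $M=(S,r)$, its loop extension is $M_o=(S\cup\{o_M\},r_o)$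 where $o_M$ is a new symbol and $r_o(A)=r(A-\{o_M\})$. A map of matroids $\tau:M\to N$ (with $M=(S,r_M)$, $N=(T,r_N)$) is a function $\tau:S\cup\{o_M\}\to T\cup\{o_N\}$ with $\tau(o_M)=o_N$; it is weak if $r_{N_o}(\tau(A))\le r_{M_o}(A)$ for all $A\subseteq S\cup\{o_M\}$, and strong if $\tau^{-1}(F)$ is a flat of $M_o$ for every flat $F$ of $N_o$. An $\mathcal L$-map $\sigma:E_1\to E_2$ is a (not necessarily linear) function such that $\sigma(V)$ is a subspace of $E_2$ for every subspace $V$ of $E_1$. The extended projective space is $\mathbb P_oE=\mathbb PE\cup\{o\}$, where $o$ plays the role of the loop $o$ of the loop extension. The induced map $\sigma_{\mathcal L}:\mathbb P_oE_1\to\mathbb P_oE_2$ sends $o$ to $o$ and a line $\ell\in\mathbb PE_1$ to the subspace $\sigma(\ell)$, which is either a line (then $\sigma_{\mathcal L}(\ell)=\sigma(\ell)$) or $\{0\}$ (then $\sigma_{\mathcal L}(\ell)=o$). A map of $q$-matroids $\sigma:\mathcal M\to\mathcal N$ is an $\mathcal L$-map $E_1\to E_2$; it is $q$-weak if $\rho_{\mathcal N}(\sigma(V))\le\rho_{\mathcal M}(V)$ for all $V\le E_1$, and $q$-strong if $\sigma^{-1}(F)$ is a flat of $\mathcal M$ for every flat $F$ of $\mathcal N$. *)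

theory Defs
  imports Complex_Main "HOL-Library.Set_Algebras"
begin

section \<open>Matroids and their maps\<close>

record 'a rank_structure =
  ground :: "'a set"
  rank :: "'a set \<Rightarrow> nat"

definition matroid :: "'a rank_structure \<Rightarrow> bool" where
  "matroid M \<longleftrightarrow> finite (ground M) \<and>
     (\<forall>A. A \<subseteq> ground M \<longrightarrow> rank M A \<le> card A) \<and>
     (\<forall>A B. A \<subseteq> B \<and> B \<subseteq> ground M \<longrightarrow> rank M A \<le> rank M B) \<and>
     (\<forall>A B. A \<subseteq> ground M \<and> B \<subseteq> ground M \<longrightarrow>
        rank M (A \<union> B) + rank M (A \<inter> B) \<le> rank M A + rank M B)"

definition flat :: "'a rank_structure \<Rightarrow> 'a set \<Rightarrow> bool" where
  "flat M F \<longleftrightarrow> F \<subseteq> ground M \<and> (\<forall>x \<in> ground M - F. rank M F < rank M (insert x F))"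

text \<open>The new loop is \<^const>\<open>None\<close>; an element \<open>x\<close> of the original ground set becomes \<open>Some x\<close>.
  The rank of a set is the rank of the original set obtained by discarding the loop.\<close>

definition loop_ext :: "'a rank_structure \<Rightarrow> 'a option rank_structure" where
  "loop_ext M = \<lparr> ground = insert None (Some ` ground M), rank = (\<lambda>A. rank M {x. Some x \<in> A}) \<rparr>"

text \<open>Only the values of \<open>\<tau>\<close> on the extended ground set are relevant.\<close>

definition matroid_map ::
    "'a rank_structure \<Rightarrow> 'b rank_structure \<Rightarrow> ('a option \<Rightarrow> 'b option) \<Rightarrow> bool" where
  "matroid_map M N \<tau> \<longleftrightarrow> matroid M \<and> matroid N \<and>
     \<tau> ` ground (loop_ext M) \<subseteq> ground (loop_ext N) \<and> \<tau> None = None"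

definition weak_map ::
    "'a rank_structure \<Rightarrow> 'b rank_structure \<Rightarrow> ('a option \<Rightarrow> 'b option) \<Rightarrow> bool" where
  "weak_map M N \<tau> \<longleftrightarrow> matroid_map M N \<tau> \<and>
     (\<forall>A. A \<subseteq> ground (loop_ext M) \<longrightarrow> rank (loop_ext N) (\<tau> ` A) \<le> rank (loop_ext M) A)"

definition strong_map ::
    "'a rank_structure \<Rightarrow> 'b rank_structure \<Rightarrow> ('a option \<Rightarrow> 'b option) \<Rightarrow> bool" where
  "strong_map M N \<tau> \<longleftrightarrow> matroid_map M N \<tau> \<and>
     (\<forall>F. flat (loop_ext N) F \<longrightarrow> flat (loop_ext M) {x \<in> ground (loop_ext M). \<tau> x \<in> F})"


section \<open>q-Matroids and their maps\<close>

text \<open>The space \<open>E\<close> is the whole type \<open>'v\<close>, finite-dimensional over the finite field \<open>'k\<close>.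
  \<open>V + W\<close> is the elementwise sum of sets. The values of \<open>\<rho>\<close> on sets that are not subspaces
  are irrelevant.\<close>

locale q_matroid = finite_dimensional_vector_space scale Basis
  for scale :: "'k::{field,finite} \<Rightarrow> 'v::ab_group_add \<Rightarrow> 'v" and Basis :: "'v set" +
  fixes \<rho> :: "'v set \<Rightarrow> nat"
  assumes rank_le_dim: "subspace V \<Longrightarrow> \<rho> V \<le> dim V"
    and rank_mono: "subspace V \<Longrightarrow> subspace W \<Longrightarrow> V \<subseteq> W \<Longrightarrow> \<rho> V \<le> \<rho> W"
    and rank_submodular: "subspace V \<Longrightarrow> subspace W \<Longrightarrow> \<rho> (V + W) + \<rho> (V \<inter> W) \<le> \<rho> V + \<rho> W"

definition q_flat ::
    "('k::field \<Rightarrow> 'v::ab_group_add \<Rightarrow> 'v) \<Rightarrow> ('v set \<Rightarrow> nat) \<Rightarrow> 'v set \<Rightarrow> bool" where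
  "q_flat scale \<rho> F \<longleftrightarrow> module.subspace scale F \<and>
     (\<forall>v. v \<notin> F \<longrightarrow> \<rho> F < \<rho> (F + module.span scale {v}))"

definition proj_space :: "('k::field \<Rightarrow> 'v::ab_group_add \<Rightarrow> 'v) \<Rightarrow> 'v set set" where
  "proj_space scale = {l. module.subspace scale l \<and> vector_space.dim scale l = 1}"

definition projectivization ::
    "('k::field \<Rightarrow> 'v::ab_group_add \<Rightarrow> 'v) \<Rightarrow> ('v set \<Rightarrow> nat) \<Rightarrow> 'v set rank_structure" where
  "projectivization scale \<rho> =
     \<lparr> ground = proj_space scale, rank = (\<lambda>S. \<rho> (module.span scale (\<Union>S))) \<rparr>"

definition L_map ::
    "('k::field \<Rightarrow> 'v::ab_group_add \<Rightarrow> 'v) \<Rightarrow> ('k \<Rightarrow> 'w::ab_group_add \<Rightarrow> 'w) \<Rightarrow> ('v \<Rightarrow> 'w) \<Rightarrow> bool" where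
  "L_map s1 s2 \<sigma> \<longleftrightarrow> (\<forall>V. module.subspace s1 V \<longrightarrow> module.subspace s2 (\<sigma> ` V))"

definition q_weak ::
    "('k::field \<Rightarrow> 'v::ab_group_add \<Rightarrow> 'v) \<Rightarrow> ('v set \<Rightarrow> nat) \<Rightarrow>
     ('k \<Rightarrow> 'w::ab_group_add \<Rightarrow> 'w) \<Rightarrow> ('w set \<Rightarrow> nat) \<Rightarrow> ('v \<Rightarrow> 'w) \<Rightarrow> bool" where
  "q_weak s1 \<rho>M s2 \<rho>N \<sigma> \<longleftrightarrow> L_map s1 s2 \<sigma> \<and>
     (\<forall>V. module.subspace s1 V \<longrightarrow> \<rho>N (\<sigma> ` V) \<le> \<rho>M V)"

definition q_strong ::
    "('k::field \<Rightarrow> 'v::ab_group_add \<Rightarrow> 'v) \<Rightarrow> ('v set \<Rightarrow> nat) \<Rightarrow>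
     ('k \<Rightarrow> 'w::ab_group_add \<Rightarrow> 'w) \<Rightarrow> ('w set \<Rightarrow> nat) \<Rightarrow> ('v \<Rightarrow> 'w) \<Rightarrow> bool" where
  "q_strong s1 \<rho>M s2 \<rho>N \<sigma> \<longleftrightarrow> L_map s1 s2 \<sigma> \<and>
     (\<forall>F. q_flat s2 \<rho>N F \<longrightarrow> q_flat s1 \<rho>M (\<sigma> -` F))"

text \<open>The extended projective space is the ground set of the loop extension of the
  projectivization matroid, so its extra point \<open>o\<close> is \<^const>\<open>None\<close>. That the image of a line
  under an L-map is a line or \<open>{0}\<close> is not built in: it is part of the claim that \<open>induced_map \<sigma>\<close>
  satisfies \<^const>\<open>matroid_map\<close>.\<close>

definition induced_map :: "('v::ab_group_add \<Rightarrow> 'w::ab_group_add) \<Rightarrow> 'v set option \<Rightarrow> 'w set option" where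
  "induced_map \<sigma> x = (case x of None \<Rightarrow> None
     | Some l \<Rightarrow> if \<sigma> ` l = {0} then None else Some (\<sigma> ` l))"

end

theory Submission
  imports Defs
begin

text \<open>
  Every flat of the loop extension of \<open>P(\<M>)\<close> contains the loop, and its other points are exactly
  the lines of a \<open>q\<close>-flat; this gives a bijection between the two kinds of flats. An L-map fixes
  \<open>0\<close>, and since a line has only \<open>q\<close> points, its restriction to a line is either zero or a
  bijection onto a line. So \<open>\<sigma>\<close> takes the set of lines of \<open>V\<close> to the set of lines of \<open>\<sigma>(V)\<close>, up to the
  loop, and \<open>\<sigma>(v) \<in> W\<close> holds if and only if \<open>\<sigma>(\<langle>v\<rangle>) \<subseteq> W\<close>. Both equivalences follow by translating
  along these correspondences.
\<close>

section \<open>Lines of a vector space and their spans\<close>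

context vector_space
begin

lemma proj_space_iff: "l \<in> proj_space scale \<longleftrightarrow> (\<exists>v. v \<noteq> 0 \<and> l = span {v})"
proof
  assume "l \<in> proj_space scale"
  then have l: "subspace l" "dim l = 1" by (auto simp: proj_space_def)
  obtain B where B: "B \<subseteq> l" "independent B" "l \<subseteq> span B" "card B = dim l"
    using basis_exists by blast
  then obtain v where v: "B = {v}" using l by (metis card_1_singletonE)
  have "span B = l" using B l span_minimal by blast
  moreover have "v \<noteq> 0" using B v dependent_zero by blast
  ultimately show "\<exists>v. v \<noteq> 0 \<and> l = span {v}" using v by auto
next
  assume "\<exists>v. v \<noteq> 0 \<and> l = span {v}"
  then obtain v where "v \<noteq> 0" "l = span {v}" by blast
  then show "l \<in> proj_space scale"
    by (auto simp: proj_space_def dim_eq_card_independent)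
qed

lemma span_singleton_in_proj_space: "v \<noteq> 0 \<Longrightarrow> span {v} \<in> proj_space scale"
  by (auto simp: proj_space_iff)

lemma subspace_of_proj_space: "l \<in> proj_space scale \<Longrightarrow> subspace l"
  by (simp add: proj_space_def)

text \<open>A nonzero vector of a line is an invertible multiple of a generator, so it generates the
  same line.\<close>

lemma line_eq_span:
  assumes "l \<in> proj_space scale" "v \<in> l" "v \<noteq> 0"
  shows "l = span {v}"
proof -
  obtain w where w: "l = span {w}" using assms(1) proj_space_iff by blast
  then obtain k where "v = k *s w" using assms(2) by (auto simp: span_singleton)
  moreover from this have "k \<noteq> 0" using assms(3) by auto
  ultimately have "w = inverse k *s v" by simp
  then have "w \<in> span {v}" by (metis span_base span_scale singletonI)
  moreover have "v \<in> span {w}" using assms(2) w by simp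
  ultimately show ?thesis using w
    by (metis empty_subsetI insert_subset span_minimal subset_antisym subspace_span)
qed

lemma span_singleton_subset_iff: "subspace V \<Longrightarrow> span {v} \<subseteq> V \<longleftrightarrow> v \<in> V"
  by (meson bot_least insert_subset span_base span_minimal singletonI subset_iff)

text \<open>Each nonzero vector lies on its own line. A subspace is thus recovered from its lines,
  and the points inside \<open>V\<close> have rank \<open>\<rho> V\<close> in the
  projectivization.\<close>

lemma span_Union_lines:
  assumes "subspace V"
  shows "span (\<Union>{l \<in> proj_space scale. l \<subseteq> V}) = V"
proof
  show "span (\<Union>{l \<in> proj_space scale. l \<subseteq> V}) \<subseteq> V"
    using assms by (intro span_minimal) auto
  show "V \<subseteq> span (\<Union>{l \<in> proj_space scale. l \<subseteq> V})"
  proof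
    fix v assume v: "v \<in> V"
    show "v \<in> span (\<Union>{l \<in> proj_space scale. l \<subseteq> V})"
    proof (cases "v = 0")
      case True
      then show ?thesis by (simp add: span_zero)
    next
      case False
      then have "span {v} \<in> {l \<in> proj_space scale. l \<subseteq> V}"
        using v assms span_singleton_in_proj_space span_singleton_subset_iff by simp
      then show ?thesis by (meson UnionI span_base singletonI)
    qed
  qed
qed

lemma span_Un_eq_plus: "span (A \<union> B) = span A + span B"
  by (auto simp: span_Un set_plus_def)

lemma span_Union_Un: "span (\<Union>(A \<union> B)) = span (\<Union>A) + span (\<Union>B)"
  by (simp add: span_Un_eq_plus)

lemma span_Union_insert:
  assumes "subspace l"
  shows "span (\<Union>(insert l S)) = span (\<Union>S) + l"
proof -
  have "span l = l" using assms span_eq_iff by blast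
  then show ?thesis by (metis Union_insert add.commute span_Un_eq_plus)
qed

text \<open>One generator per line suffices to span all the lines. This bounds the rank of a set of
  points by its cardinality.\<close>

lemma dim_span_Union_lines_le_card:
  assumes "finite S" "S \<subseteq> proj_space scale"
  shows "dim (span (\<Union>S)) \<le> card S"
proof -
  have "\<forall>l\<in>S. \<exists>v. l = span {v}" using assms(2) proj_space_iff by blast
  then obtain g where g: "\<And>l. l \<in> S \<Longrightarrow> l = span {g l}" by metis
  have "\<Union>S \<subseteq> span (g ` S)"
  proof
    fix x assume "x \<in> \<Union>S"
    then obtain l where l: "l \<in> S" "x \<in> l" by blast
    then have "x \<in> span {g l}" using g by blast
    moreover have "span {g l} \<subseteq> span (g ` S)" using l by (intro span_mono) auto
    ultimately show "x \<in> span (g ` S)" by blast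
  qed
  then have "dim (\<Union>S) \<le> card (g ` S)"
    using assms(1) by (intro dim_le_card) auto
  also have "\<dots> \<le> card S" using assms(1) by (rule card_image_le)
  finally show ?thesis by simp
qed

end

section \<open>The projectivization matroid and the flats of its loop extension\<close>

context q_matroid
begin

abbreviation lines_in :: "'v set \<Rightarrow> 'v set set"
  where "lines_in V \<equiv> {l \<in> proj_space scale. l \<subseteq> V}"

abbreviation P :: "'v set rank_structure"
  where "P \<equiv> projectivization scale \<rho>"

text \<open>Adding a generator multiplies the number of vectors by at most the size of the field.
  Finiteness of the whole space then makes the set of points finite and permits counting on
  lines.\<close>

lemma finite_span:
  assumes "finite S"
  shows "finite (span S)"
  using assms
proof induction
  case (insert a S)
  have "span (insert a S) \<subseteq> (\<lambda>(k, y). scale k a + y) ` (UNIV \<times> span S)"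
  proof
    fix x assume "x \<in> span (insert a S)"
    then obtain k where "x - scale k a \<in> span S" by (auto simp: span_insert)
    moreover have "x = scale k a + (x - scale k a)" by simp
    ultimately show "x \<in> (\<lambda>(k, y). scale k a + y) ` (UNIV \<times> span S)"
      by (metis (no_types, lifting) SigmaI UNIV_I case_prod_conv image_eqI)
  qed
  then show ?case using insert by (meson finite_SigmaI finite_imageI finite finite_subset)
qed simp

lemma finite_space: "finite (UNIV :: 'v set)"
  using finite_span[OF finite_Basis] span_Basis by simp

text \<open>Scalars parametrize a line bijectively through any generator. The count depends on the
  field alone, so it can compare lines of two different spaces.\<close>

lemma card_line: "l \<in> proj_space scale \<Longrightarrow> card l = card (UNIV :: 'k set)"
proof -
  assume "l \<in> proj_space scale"
  then obtain v where v: "v \<noteq> 0" "l = span {v}" using proj_space_iff by blast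
  then have "inj (\<lambda>k. scale k v)" by (auto intro: injI)
  then show ?thesis by (simp add: v(2) span_singleton card_image)
qed

lemma ground_P [simp]: "ground P = proj_space scale"
  by (simp add: projectivization_def)

lemma rank_P [simp]: "rank P S = \<rho> (span (\<Union>S))"
  by (simp add: projectivization_def)

lemma matroid_projectivization: "matroid P"
  unfolding matroid_def
proof (intro conjI allI impI)
  show fin: "finite (ground P)"
    using finite_space by (meson Finite_Set.finite_set finite_subset subset_UNIV)
  fix A assume "A \<subseteq> ground P"
  then have "finite A" "A \<subseteq> proj_space scale" using fin finite_subset by auto
  then show "rank P A \<le> card A"
    using dim_span_Union_lines_le_card rank_le_dim[of "span (\<Union>A)"] by fastforce
next
  fix A B assume "A \<subseteq> B \<and> B \<subseteq> ground P"
  then have "span (\<Union>A) \<subseteq> span (\<Union>B)" by (intro span_mono) auto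
  then show "rank P A \<le> rank P B" by (simp add: rank_mono)
next
  fix A B
  \<comment> \<open>Spans turn unions of point sets into sums, but intersections only into an
    inclusion; monotonicity of \<open>\<rho>\<close> bridges this gap.\<close>
  have "span (\<Union>(A \<inter> B)) \<subseteq> span (\<Union>A) \<inter> span (\<Union>B)"
    by (intro Int_greatest span_mono) auto
  then have "\<rho> (span (\<Union>(A \<inter> B))) \<le> \<rho> (span (\<Union>A) \<inter> span (\<Union>B))"
    by (intro rank_mono) (auto intro: subspace_inter)
  then show "rank P (A \<union> B) + rank P (A \<inter> B) \<le> rank P A + rank P B"
    using rank_submodular[of "span (\<Union>A)" "span (\<Union>B)"] unfolding rank_P span_Union_Un
    by (simp add: subspace_span)
qed

lemma ground_loop_ext_P: "ground (loop_ext P) = insert None (Some ` proj_space scale)"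
  by (simp add: loop_ext_def)

lemma rank_loop_ext_P: "rank (loop_ext P) A = \<rho> (span (\<Union>{l. Some l \<in> A}))"
  by (simp add: loop_ext_def)

text \<open>A point outside the set is generated by some \<open>v\<close> outside \<open>W\<close>,
  and adding it replaces the span \<open>W\<close> by \<open>W + l\<close>, where the rank
  jumps.\<close>

lemma flat_of_q_flat:
  assumes "q_flat scale \<rho> W"
  shows "flat (loop_ext P) (insert None (Some ` lines_in W))"
  unfolding flat_def
proof (intro conjI ballI)
  have W: "subspace W" using assms by (simp add: q_flat_def)
  show "insert None (Some ` lines_in W) \<subseteq> ground (loop_ext P)"
    by (auto simp: ground_loop_ext_P)
  fix x assume "x \<in> ground (loop_ext P) - insert None (Some ` lines_in W)"
  then obtain l where l: "x = Some l" "l \<in> proj_space scale" "\<not> l \<subseteq> W"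
    unfolding ground_loop_ext_P by blast
  obtain v where v: "l = span {v}" using l(2) proj_space_iff by blast
  then have "v \<notin> W" using l(3) W span_singleton_subset_iff by blast
  then have "\<rho> W < \<rho> (W + l)" using assms v by (simp add: q_flat_def)
  moreover have "{k. Some k \<in> insert x (insert None (Some ` lines_in W))} = insert l (lines_in W)"
    using l by auto
  moreover have "{k. Some k \<in> insert None (Some ` lines_in W)} = lines_in W" by auto
  ultimately show "rank (loop_ext P) (insert None (Some ` lines_in W))
      < rank (loop_ext P) (insert x (insert None (Some ` lines_in W)))"
    using W l(2)
    by (simp only: rank_loop_ext_P span_Union_insert[OF subspace_of_proj_space] span_Union_lines)
qed

text \<open>The witness is the span of the points of \<open>F\<close>. Flatness forces every line of
  this span to be among those points already.\<close>

lemma flat_imp_q_flat: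
  assumes F: "flat (loop_ext P) F"
  obtains W where "q_flat scale \<rho> W" "F = insert None (Some ` lines_in W)"
proof -
  define S where "S = {l. Some l \<in> F}"
  define W where "W = span (\<Union>S)"
  have W: "subspace W" by (simp add: W_def)
  have S: "S \<subseteq> proj_space scale"
    using F by (auto simp: flat_def ground_loop_ext_P S_def)
  \<comment> \<open>Adding the loop never changes the rank, so no flat can omit it.\<close>
  have "None \<in> F"
  proof (rule ccontr)
    assume "None \<notin> F"
    then have "rank (loop_ext P) F < rank (loop_ext P) (insert None F)"
      using F by (simp add: flat_def ground_loop_ext_P)
    then show False by (simp add: rank_loop_ext_P)
  qed
  have less: "\<rho> W < \<rho> (W + l)" if l: "l \<in> proj_space scale" "l \<notin> S" for l
  proof -
    have "Some l \<in> ground (loop_ext P) - F" using l by (simp add: ground_loop_ext_P S_def)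
    then have "rank (loop_ext P) F < rank (loop_ext P) (insert (Some l) F)"
      using F by (simp add: flat_def)
    moreover have "{k. Some k \<in> insert (Some l) F} = insert l S" by (auto simp: S_def)
    ultimately show ?thesis
      using l by (simp only: rank_loop_ext_P S_def[symmetric] W_def
        span_Union_insert[OF subspace_of_proj_space])
  qed
  have "S = lines_in W"
  proof
    show "S \<subseteq> lines_in W" using S span_superset unfolding W_def by blast
    show "lines_in W \<subseteq> S"
    proof
      fix l assume l: "l \<in> lines_in W"
      \<comment> \<open>A line inside \<open>W\<close> satisfies \<open>W + l = W\<close>; if it
        were missing from \<open>S\<close>, adding it would have to raise the rank.\<close>
      have "span W = W" "span l = l" using l W subspace_of_proj_space span_eq_iff by blast+
      then have "W + l = span (W \<union> l)" by (metis span_Un_eq_plus)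
      also have "\<dots> = W" using l \<open>span W = W\<close> by (simp add: Un_absorb2)
      finally show "l \<in> S" using less[of l] l by auto
    qed
  qed
  have "x \<in> F \<longleftrightarrow> x \<in> insert None (Some ` S)" for x
  proof (cases x)
    case None
    then show ?thesis using \<open>None \<in> F\<close> by simp
  next
    case (Some l)
    then show ?thesis by (simp add: S_def image_iff)
  qed
  then have "F = insert None (Some ` lines_in W)" unfolding \<open>S = lines_in W\<close> by (rule set_eqI)
  moreover have "q_flat scale \<rho> W"
    unfolding q_flat_def
  proof (intro conjI allI impI)
    show "subspace W" by (fact W)
    fix v assume v: "v \<notin> W"
    then have "v \<noteq> 0" using W subspace_0 by blast
    moreover have "\<not> span {v} \<subseteq> W" using v W span_singleton_subset_iff by blast
    ultimately show "\<rho> W < \<rho> (W + span {v})"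
      using less span_singleton_in_proj_space \<open>S = lines_in W\<close> by blast
  qed
  ultimately show ?thesis using that by blast
qed

end

section \<open>L-maps and the maps they induce on points\<close>

locale q_matroid_L_map =
  M: q_matroid s1 B1 \<rho>M + N: q_matroid s2 B2 \<rho>N
  for s1 :: "'k::{field,finite} \<Rightarrow> 'v::ab_group_add \<Rightarrow> 'v" and B1 \<rho>M
    and s2 :: "'k \<Rightarrow> 'w::ab_group_add \<Rightarrow> 'w" and B2 \<rho>N +
  fixes \<sigma> :: "'v \<Rightarrow> 'w"
  assumes L_map: "L_map s1 s2 \<sigma>"
begin

lemma subspace_image: "M.subspace V \<Longrightarrow> N.subspace (\<sigma> ` V)"
  using L_map by (simp add: L_map_def)

text \<open>The image of the zero subspace is a subspace with a single element.\<close>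

lemma map_zero: "\<sigma> 0 = 0"
  using N.subspace_0[OF subspace_image[OF M.subspace_single_0]] by (metis imageE singletonD)

text \<open>A nonzero value on a line forces its image, which has at most \<open>q\<close> elements, to contain the
  \<open>q\<close> multiples of that value.\<close>

lemma image_line:
  assumes "l \<in> proj_space s1" "\<sigma> ` l \<noteq> {0}"
  shows "\<sigma> ` l \<in> proj_space s2" and "inj_on \<sigma> l"
proof -
  have fin: "finite l" by (rule finite_subset[OF subset_UNIV M.finite_space])
  have sub: "N.subspace (\<sigma> ` l)" using assms(1) M.subspace_of_proj_space subspace_image by blast
  have "0 \<in> \<sigma> ` l" using sub N.subspace_0 by blast
  then obtain w where w: "w \<in> \<sigma> ` l" "w \<noteq> 0" using assms(2) by blast
  then have line: "N.span {w} \<in> proj_space s2" by (simp add: N.span_singleton_in_proj_space)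
  have subset: "N.span {w} \<subseteq> \<sigma> ` l" using w sub N.span_singleton_subset_iff by blast
  have card: "card (N.span {w}) = card l" using line assms(1) M.card_line N.card_line by simp
  have le: "card (\<sigma> ` l) \<le> card l" using fin by (rule card_image_le)
  have eq: "N.span {w} = \<sigma> ` l"
    using subset fin le card by (intro card_seteq) auto
  then show "\<sigma> ` l \<in> proj_space s2" using line by simp
  show "inj_on \<sigma> l" using eq card fin by (intro eq_card_imp_inj_on) auto
qed

text \<open>This replaces linearity: although \<sigma> need not respect scalars, the image of the
  line through \<open>v\<close> is either zero or the line through
  \<open>\<sigma> v\<close>.\<close>

lemma image_span_singleton_subset_iff:
  assumes "N.subspace W"
  shows "\<sigma> ` M.span {v} \<subseteq> W \<longleftrightarrow> \<sigma> v \<in> W"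
proof
  assume "\<sigma> ` M.span {v} \<subseteq> W"
  then show "\<sigma> v \<in> W" using M.span_base by blast
next
  assume v: "\<sigma> v \<in> W"
  show "\<sigma> ` M.span {v} \<subseteq> W"
  proof (cases "v = 0 \<or> \<sigma> ` M.span {v} = {0}")
    case True
    then have "\<sigma> ` M.span {v} = {0}" using map_zero by auto
    then show ?thesis using assms N.subspace_0 by simp
  next
    case False
    then have line: "M.span {v} \<in> proj_space s1" by (simp add: M.span_singleton_in_proj_space)
    have v_in: "v \<in> M.span {v}" by (simp add: M.span_base)
    \<comment> \<open>On a line that does not collapse, \<sigma> is injective, and the value 0 is
      already taken at 0.\<close>
    have "\<sigma> v \<noteq> 0"
      using inj_onD[OF image_line(2)[OF line], of v 0] False v_in map_zero M.span_zero by metis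
    then have "\<sigma> ` M.span {v} = N.span {\<sigma> v}"
      using False image_line(1)[OF line] v_in by (intro N.line_eq_span) auto
    then show ?thesis using v assms N.span_singleton_subset_iff by simp
  qed
qed

lemma induced_map_None [simp]: "induced_map \<sigma> None = None"
  by (simp add: induced_map_def)

lemma matroid_map_induced_map: "matroid_map M.P N.P (induced_map \<sigma>)"
  unfolding matroid_map_def
proof (intro conjI)
  show "induced_map \<sigma> ` ground (loop_ext M.P) \<subseteq> ground (loop_ext N.P)"
  proof
    fix y assume "y \<in> induced_map \<sigma> ` ground (loop_ext M.P)"
    then consider "y = None" | l where "l \<in> proj_space s1" "y = induced_map \<sigma> (Some l)"
      by (auto simp: M.ground_loop_ext_P)
    then show "y \<in> ground (loop_ext N.P)"
      by cases (simp_all add: N.ground_loop_ext_P induced_map_def image_line(1))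
  qed
qed (simp_all add: M.matroid_projectivization N.matroid_projectivization)

text \<open>Collapsed lines go to the loop, which the rank discards, so only lines with nonzero
  image contribute.\<close>

lemma points_image_induced_map:
  "{k. Some k \<in> induced_map \<sigma> ` A} = {\<sigma> ` l |l. Some l \<in> A \<and> \<sigma> ` l \<noteq> {0}}"
proof -
  have "induced_map \<sigma> x = Some k \<longleftrightarrow> (\<exists>l. x = Some l \<and> \<sigma> ` l \<noteq> {0} \<and> k = \<sigma> ` l)" for x k
    by (cases x) (simp_all add: induced_map_def eq_commute[of k])
  then show ?thesis
    by (simp add: image_iff eq_commute[of "Some _"]) blast
qed

lemma q_weak_iff_weak:
  "q_weak s1 \<rho>M s2 \<rho>N \<sigma> \<longleftrightarrow> weak_map M.P N.P (induced_map \<sigma>)"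
proof
  assume weak: "q_weak s1 \<rho>M s2 \<rho>N \<sigma>"
  have "rank (loop_ext N.P) (induced_map \<sigma> ` A) \<le> rank (loop_ext M.P) A" for A
  proof -
    \<comment> \<open>All points of \<open>A\<close> lie in \<open>V\<close>, so the subspace
      \<open>\<sigma>(V)\<close> contains the span of their images.\<close>
    define V where "V = M.span (\<Union>{l. Some l \<in> A})"
    have V: "M.subspace V" by (simp add: V_def)
    have "\<Union>{l. Some l \<in> A} \<subseteq> V" unfolding V_def by (rule M.span_superset)
    then have "\<Union>{k. Some k \<in> induced_map \<sigma> ` A} \<subseteq> \<sigma> ` V"
      unfolding points_image_induced_map by blast
    then have "N.span (\<Union>{k. Some k \<in> induced_map \<sigma> ` A}) \<subseteq> \<sigma> ` V"
      using subspace_image[OF V] by (rule N.span_minimal)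
    then have "rank (loop_ext N.P) (induced_map \<sigma> ` A) \<le> \<rho>N (\<sigma> ` V)"
      unfolding N.rank_loop_ext_P using subspace_image[OF V] by (intro N.rank_mono) simp_all
    also have "\<dots> \<le> \<rho>M V" using weak V by (simp add: q_weak_def)
    finally show ?thesis by (simp add: M.rank_loop_ext_P V_def)
  qed
  then show "weak_map M.P N.P (induced_map \<sigma>)"
    by (simp add: weak_map_def matroid_map_induced_map)
next
  assume weak: "weak_map M.P N.P (induced_map \<sigma>)"
  have "\<rho>N (\<sigma> ` V) \<le> \<rho>M V" if V: "M.subspace V" for V
  proof -
    \<comment> \<open>Testing weakness on all lines of \<open>V\<close> suffices: they have rank
      \<open>\<rho>M V\<close>, and their images span a subspace containing
      \<open>\<sigma>(V)\<close>.\<close>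
    define A where "A = Some ` M.lines_in V"
    have points: "{l. Some l \<in> A} = M.lines_in V" by (auto simp: A_def)
    have A: "A \<subseteq> ground (loop_ext M.P)" unfolding A_def M.ground_loop_ext_P by blast
    let ?U = "N.span (\<Union>{k. Some k \<in> induced_map \<sigma> ` A})"
    have "\<sigma> v \<in> ?U" if v: "v \<in> V" for v
    proof (cases "\<sigma> v = 0")
      case True
      then show ?thesis by (simp add: N.span_zero)
    next
      case False
      then have "v \<noteq> 0" using map_zero by auto
      then have l: "M.span {v} \<in> M.lines_in V"
        using v V M.span_singleton_in_proj_space M.span_singleton_subset_iff by simp
      \<comment> \<open>A nonzero value at \<open>v\<close> keeps this line from collapsing, so its
        image is one of the points that span \<open>?U\<close>.\<close>
      have "\<sigma> v \<in> \<sigma> ` M.span {v}" by (simp add: M.span_base)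
      moreover from this have "\<sigma> ` M.span {v} \<noteq> {0}" using False by blast
      ultimately have "\<sigma> v \<in> \<Union>{k. Some k \<in> induced_map \<sigma> ` A}"
        using l points unfolding points_image_induced_map by blast
      then show ?thesis by (rule N.span_base)
    qed
    then have "\<rho>N (\<sigma> ` V) \<le> \<rho>N ?U" using subspace_image[OF V] by (intro N.rank_mono) auto
    also have "\<dots> = rank (loop_ext N.P) (induced_map \<sigma> ` A)" by (simp add: N.rank_loop_ext_P)
    also have "\<dots> \<le> rank (loop_ext M.P) A"
      using weak A by (simp add: weak_map_def)
    also have "\<dots> = \<rho>M V" using V by (simp add: M.rank_loop_ext_P points M.span_Union_lines)
    finally show ?thesis .
  qed
  then show "q_weak s1 \<rho>M s2 \<rho>N \<sigma>" using L_map by (simp add: q_weak_def)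
qed

text \<open>A collapsed line is sent to the loop, which is in the flat, and its image
  \<open>{0}\<close> lies in every subspace. The two sides therefore also agree on such
  lines.\<close>

lemma vimage_induced_map:
  assumes "N.subspace W"
  shows "{x \<in> ground (loop_ext M.P). induced_map \<sigma> x \<in> insert None (Some ` N.lines_in W)}
    = insert None (Some ` M.lines_in (\<sigma> -` W))"
proof -
  have iff: "induced_map \<sigma> (Some l) \<in> insert None (Some ` N.lines_in W) \<longleftrightarrow> l \<subseteq> \<sigma> -` W"
    if l: "l \<in> proj_space s1" for l
  proof (cases "\<sigma> ` l = {0}")
    case True
    then have "\<sigma> ` l \<subseteq> W" using N.subspace_0[OF assms] by simp
    moreover have "induced_map \<sigma> (Some l) = None" using True by (simp add: induced_map_def)
    ultimately show ?thesis by (simp add: image_subset_iff_subset_vimage)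
  next
    case False
    then have "induced_map \<sigma> (Some l) = Some (\<sigma> ` l)" by (simp add: induced_map_def)
    then show ?thesis using image_line(1)[OF l False]
      by (simp add: image_subset_iff_subset_vimage image_iff)
  qed
  have "x \<in> ground (loop_ext M.P) \<and> induced_map \<sigma> x \<in> insert None (Some ` N.lines_in W)
      \<longleftrightarrow> x \<in> insert None (Some ` M.lines_in (\<sigma> -` W))" for x
  proof (cases x)
    case None
    then show ?thesis by (simp add: M.ground_loop_ext_P)
  next
    case (Some l)
    have member: "Some a \<in> insert None (Some ` X) \<longleftrightarrow> a \<in> X" for a :: "'v set" and X by blast
    show ?thesis
      unfolding Some M.ground_loop_ext_P member mem_Collect_eq by (rule conj_cong[OF refl iff])
  qed
  then show ?thesis unfolding set_eq_iff mem_Collect_eq by (rule allI)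
qed

lemma q_strong_iff_strong:
  "q_strong s1 \<rho>M s2 \<rho>N \<sigma> \<longleftrightarrow> strong_map M.P N.P (induced_map \<sigma>)"
proof
  assume strong: "q_strong s1 \<rho>M s2 \<rho>N \<sigma>"
  have "flat (loop_ext M.P) {x \<in> ground (loop_ext M.P). induced_map \<sigma> x \<in> F}"
    if F: "flat (loop_ext N.P) F" for F
  proof -
    obtain W where W: "q_flat s2 \<rho>N W" "F = insert None (Some ` N.lines_in W)"
      using N.flat_imp_q_flat[OF F] by blast
    moreover have "q_flat s1 \<rho>M (\<sigma> -` W)" using strong W(1) by (simp add: q_strong_def)
    moreover have "N.subspace W" using W(1) by (simp add: q_flat_def)
    ultimately show ?thesis by (simp only: vimage_induced_map M.flat_of_q_flat)
  qed
  then show "strong_map M.P N.P (induced_map \<sigma>)"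
    by (simp add: strong_map_def matroid_map_induced_map)
next
  assume strong: "strong_map M.P N.P (induced_map \<sigma>)"
  have "q_flat s1 \<rho>M (\<sigma> -` W)" if W: "q_flat s2 \<rho>N W" for W
  proof -
    have sub: "N.subspace W" using W by (simp add: q_flat_def)
    have "flat (loop_ext M.P) (insert None (Some ` M.lines_in (\<sigma> -` W)))"
      using strong N.flat_of_q_flat[OF W]
      unfolding strong_map_def vimage_induced_map[OF sub, symmetric] by blast
    \<comment> \<open>At this point the preimage of \<open>W\<close> is only known to contain the
      same lines as the q-flat \<open>V\<close>. Comparing vectors through the lines they generate
      shows that the two sets coincide.\<close>
    then obtain V where V: "q_flat s1 \<rho>M V"
      "insert None (Some ` M.lines_in (\<sigma> -` W)) = insert None (Some ` M.lines_in V)"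
      by (rule M.flat_imp_q_flat)
    have subV: "M.subspace V" using V(1) by (simp add: q_flat_def)
    have lines: "M.lines_in (\<sigma> -` W) = M.lines_in V"
      using V(2) by blast
    have "v \<in> \<sigma> -` W \<longleftrightarrow> v \<in> V" for v
    proof (cases "v = 0")
      case True
      then show ?thesis using sub subV N.subspace_0 M.subspace_0 map_zero by auto
    next
      case False
      have "v \<in> \<sigma> -` W \<longleftrightarrow> M.span {v} \<subseteq> \<sigma> -` W"
        using image_span_singleton_subset_iff[OF sub] by auto
      also have "\<dots> \<longleftrightarrow> M.span {v} \<subseteq> V"
        using lines M.span_singleton_in_proj_space[OF False] by blast
      also have "\<dots> \<longleftrightarrow> v \<in> V" by (rule M.span_singleton_subset_iff[OF subV])
      finally show ?thesis .
    qed
    then have "\<sigma> -` W = V" by blast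
    then show ?thesis using V(1) by simp
  qed
  then show "q_strong s1 \<rho>M s2 \<rho>N \<sigma>" using L_map by (simp add: q_strong_def)
qed

end

theorem theorem4p6:
  fixes s1 :: "'k::{field,finite} \<Rightarrow> 'v::ab_group_add \<Rightarrow> 'v"
    and s2 :: "'k \<Rightarrow> 'w::ab_group_add \<Rightarrow> 'w"
    and B1 :: "'v set" and B2 :: "'w set"
    and \<rho>M :: "'v set \<Rightarrow> nat" and \<rho>N :: "'w set \<Rightarrow> nat"
    and \<sigma> :: "'v \<Rightarrow> 'w"
  assumes "q_matroid s1 B1 \<rho>M"
    and "q_matroid s2 B2 \<rho>N"
    and "L_map s1 s2 \<sigma>"
  shows "matroid_map (projectivization s1 \<rho>M) (projectivization s2 \<rho>N) (induced_map \<sigma>) \<and>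
    (q_weak s1 \<rho>M s2 \<rho>N \<sigma> \<longleftrightarrow>
       weak_map (projectivization s1 \<rho>M) (projectivization s2 \<rho>N) (induced_map \<sigma>)) \<and>
    (q_strong s1 \<rho>M s2 \<rho>N \<sigma> \<longleftrightarrow>
       strong_map (projectivization s1 \<rho>M) (projectivization s2 \<rho>N) (induced_map \<sigma>))"
proof -
  interpret q_matroid_L_map s1 B1 \<rho>M s2 B2 \<rho>N \<sigma>
    using assms by (simp add: q_matroid_L_map_def q_matroid_L_map_axioms_def)
  show ?thesis
    using matroid_map_induced_map q_weak_iff_weak q_strong_iff_strong by blast
qed

end
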